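(* Let $n\ge1$ and $m\ge2$. There exists a subgraph of the Hamming graph $K_m^n$ that is isomorphic to $S(n,m)$; equivalently, there is a bijection $\varphi:\{0,\dots,m-1\}^n\to\{0,\dots,m-1\}^n$ such that for every edge $\{u,v\}$ of $S(n,m)$, the $n$-tuples $\varphi(u)$ and $\varphi(v)$ differ in exactly one coordinate.
   Context: For $n\ge1$, $m\ge2$, the Sierpinski graph $S(n,m)$ has vertex set $\{0,1,\dots,m-1\}^n$, and two distinct vertices $u,v$ are adjacent iff there exists $h\in\{1,\dots,n\}$ such that: $u_i=v_i$ for $i<h$; $u_h\neq v_h$; and $u_j=v_h$, $v_j=u_h$ for all $j>h$. The Hamming graph $K_m^n$ has vertex set $\{0,1,\dots,m-1\}^n$, two vertices being adjacent iff they differ in exactly one coordinate. *)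

theory Defs
  imports "Graph_Theory.Digraph_Isomorphism"
begin

text \<open>
  An undirected simple graph is a \<^locale>\<open>pair_graph\<close>: an edge \<open>{u, v}\<close> is the pair of arcs
  \<open>(u, v)\<close>, \<open>(v, u)\<close>. An \<open>n\<close>-tuple is a list of length \<open>n\<close>; positions are counted from 0,
  so the coordinate \<open>u\<^sub>h\<close> is \<open>u ! (h - 1)\<close>.
\<close>

definition tuples :: "nat \<Rightarrow> nat \<Rightarrow> nat list set" where
  "tuples n m = {u. length u = n \<and> set u \<subseteq> {0..<m}}"

definition sierpinski_graph :: "nat \<Rightarrow> nat \<Rightarrow> nat list pair_pre_digraph" where
  "sierpinski_graph n m =
    \<lparr> pverts = tuples n m,
      parcs = {(u, v). u \<in> tuples n m \<and> v \<in> tuples n m \<and> u \<noteq> v \<and>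
        (\<exists>h<n. (\<forall>i<h. u ! i = v ! i) \<and> u ! h \<noteq> v ! h \<and>
          (\<forall>j. h < j \<and> j < n \<longrightarrow> u ! j = v ! h \<and> v ! j = u ! h))} \<rparr>"

definition hamming_graph :: "nat \<Rightarrow> nat \<Rightarrow> nat list pair_pre_digraph" where
  "hamming_graph n m =
    \<lparr> pverts = tuples n m,
      parcs = {(u, v). u \<in> tuples n m \<and> v \<in> tuples n m \<and> (\<exists>!i. i < n \<and> u ! i \<noteq> v ! i)} \<rparr>"

lemma finite_tuples: "finite (tuples n m)"
  unfolding tuples_def using finite_lists_length_eq[of "{0..<m}" n]
  by (simp add: conj_commute)

lemma pverts_sierpinski_graph [simp]: "pverts (sierpinski_graph n m) = tuples n m"
  and pverts_hamming_graph [simp]: "pverts (hamming_graph n m) = tuples n m"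
  by (simp_all add: sierpinski_graph_def hamming_graph_def)

lemma parcs_sierpinski_graph_iff:
  "(u, v) \<in> parcs (sierpinski_graph n m) \<longleftrightarrow>
    u \<in> tuples n m \<and> v \<in> tuples n m \<and> u \<noteq> v \<and>
    (\<exists>h<n. (\<forall>i<h. u ! i = v ! i) \<and> u ! h \<noteq> v ! h \<and>
      (\<forall>j. h < j \<and> j < n \<longrightarrow> u ! j = v ! h \<and> v ! j = u ! h))"
  unfolding sierpinski_graph_def pair_pre_digraph.select_convs mem_Collect_eq case_prod_conv ..

lemma parcs_hamming_graph_iff:
  "(u, v) \<in> parcs (hamming_graph n m) \<longleftrightarrow>
    u \<in> tuples n m \<and> v \<in> tuples n m \<and> (\<exists>!i. i < n \<and> u ! i \<noteq> v ! i)"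
  unfolding hamming_graph_def pair_pre_digraph.select_convs mem_Collect_eq case_prod_conv ..

lemma pair_graphI_tuples:
  assumes "pverts G = tuples n m"
    and "\<And>u v. (u, v) \<in> parcs G \<Longrightarrow> u \<in> tuples n m \<and> v \<in> tuples n m \<and> u \<noteq> v \<and> (v, u) \<in> parcs G"
  shows "pair_graph G"
proof
  have "parcs G \<subseteq> tuples n m \<times> tuples n m"
    using assms(2) by fast
  then show "finite (parcs G)"
    by (rule finite_subset) (simp add: finite_tuples)
  show "symmetric (with_proj G)"
    unfolding symmetric_def with_proj_simps by (rule symI) (use assms(2) in blast)
  show "finite (pverts G)"
    by (simp add: assms(1) finite_tuples)
  show "fst e \<in> pverts G" "snd e \<in> pverts G" "fst e \<noteq> snd e" if "e \<in> parcs G" for e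
    using assms(2)[of "fst e" "snd e"] that by (simp_all add: assms(1))
qed

lemma pair_graph_sierpinski_graph: "pair_graph (sierpinski_graph n m)"
proof (rule pair_graphI_tuples)
  fix u v assume uv: "(u, v) \<in> parcs (sierpinski_graph n m)"
  then obtain h where h: "h < n" "\<forall>i<h. u ! i = v ! i" "u ! h \<noteq> v ! h"
      "\<forall>j. h < j \<and> j < n \<longrightarrow> u ! j = v ! h \<and> v ! j = u ! h"
    unfolding parcs_sierpinski_graph_iff by blast
  have "(\<forall>i<h. v ! i = u ! i) \<and> v ! h \<noteq> u ! h \<and>
      (\<forall>j. h < j \<and> j < n \<longrightarrow> v ! j = u ! h \<and> u ! j = v ! h)"
    using h by metis
  then show "u \<in> tuples n m \<and> v \<in> tuples n m \<and> u \<noteq> v \<and> (v, u) \<in> parcs (sierpinski_graph n m)"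
    using uv h(1) unfolding parcs_sierpinski_graph_iff by blast
qed simp

lemma pair_graph_hamming_graph: "pair_graph (hamming_graph n m)"
proof (rule pair_graphI_tuples)
  fix u v assume uv: "(u, v) \<in> parcs (hamming_graph n m)"
  have "(\<lambda>i. i < n \<and> v ! i \<noteq> u ! i) = (\<lambda>i. i < n \<and> u ! i \<noteq> v ! i)"
    by fastforce
  then show "u \<in> tuples n m \<and> v \<in> tuples n m \<and> u \<noteq> v \<and> (v, u) \<in> parcs (hamming_graph n m)"
    using uv unfolding parcs_hamming_graph_iff by auto
qed simp

end

theory Submission
  imports Defs "HOL-Number_Theory.Cong"
begin

text \<open>
  The endpoints of an edge of \<open>S(n,m)\<close> at position \<open>h\<close> differ, as vectors over the integers
  modulo \<open>m\<close>, by a nonzero multiple of \<open>b\<^sub>h = e\<^sub>h - (e\<^bsub>h+1\<^esub> + \<dots> + e\<^sub>n)\<close>. The vectors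
  \<open>b\<^sub>1, \<dots>, b\<^sub>n\<close> form a basis because their matrix is unitriangular, so the linear bijection
  taking each \<open>b\<^sub>h\<close> to \<open>e\<^sub>h\<close> turns every edge into a change of the single coordinate \<open>h\<close>.
  Explicitly, \<open>u\<close> is sent to the tuple \<open>c\<close> with \<open>c\<^sub>k = u\<^sub>k + (c\<^sub>1 + \<dots> + c\<^bsub>k-1\<^esub>)\<close> modulo \<open>m\<close>.
\<close>

text \<open>The accumulator \<open>s\<close> is the sum of the coordinates of the image produced so far.\<close>

fun sum_code :: "nat \<Rightarrow> nat \<Rightarrow> nat list \<Rightarrow> nat list" where
  "sum_code m s [] = []"
| "sum_code m s (x # xs) = (let c = (s + x) mod m in c # sum_code m (s + c) xs)"

lemma length_sum_code [simp]: "length (sum_code m s u) = length u"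
  by (induction u arbitrary: s) (auto simp: Let_def)

lemma set_sum_code_subset: "m > 0 \<Longrightarrow> set (sum_code m s u) \<subseteq> {0..<m}"
  by (induction u arbitrary: s) (auto simp: Let_def)

text \<open>Lets the common prefix of the two endpoints of an edge be split off: it contributes the
  same entries to both images and leaves both with the same accumulator.\<close>

lemma sum_code_append:
  "sum_code m s (u @ v) = sum_code m s u @ sum_code m (s + sum_list (sum_code m s u)) v"
  by (induction u arbitrary: s) (simp_all add: Let_def add.assoc)

lemma mod_add_left_cancel_less:
  fixes s x y m :: nat
  assumes "(s + x) mod m = (s + y) mod m" "x < m" "y < m"
  shows "x = y"
proof -
  have "[s + x = s + y] (mod m)"
    using assms(1) by (simp add: cong_def)
  then have "[x = y] (mod m)"
    by (simp only: cong_add_lcancel_nat)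
  then show ?thesis
    using assms(2,3) by (rule cong_less_modulus_unique_nat)
qed

text \<open>Decoding runs from left to right: with \<open>s\<close> known, the first entry
  determines \<open>x\<close> modulo \<open>m\<close>, hence \<open>x\<close> itself, and both tails
  are then coded from the same new accumulator. This is why \<open>s\<close> is generalised in the
  induction.\<close>

lemma sum_code_inject:
  assumes "sum_code m s u = sum_code m s v" "set u \<subseteq> {0..<m}" "set v \<subseteq> {0..<m}"
  shows "u = v"
  using assms
proof (induction u arbitrary: s v)
  case Nil
  then show ?case
    by (cases v) (auto simp: Let_def)
next
  case (Cons x u)
  obtain y w where v: "v = y # w"
    using Cons.prems(1) by (cases v) (auto simp: Let_def)
  have c: "(s + x) mod m = (s + y) mod m"
    using Cons.prems(1) by (simp add: v Let_def)
  moreover have "x < m" "y < m"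
    using Cons.prems(2,3) by (auto simp: v)
  ultimately have "x = y"
    by (rule mod_add_left_cancel_less)
  moreover have "u = w"
    using Cons.prems c by (intro Cons.IH[of "s + (s + x) mod m" w]) (auto simp: v Let_def)
  ultimately show ?case
    by (simp add: v)
qed

lemma bij_betw_sum_code:
  assumes "m > 0"
  shows "bij_betw (sum_code m s) (tuples n m) (tuples n m)"
proof (rule bij_betw_imageI)
  show inj: "inj_on (sum_code m s) (tuples n m)"
    by (rule inj_onI) (auto simp: tuples_def intro: sum_code_inject)
  have "sum_code m s ` tuples n m \<subseteq> tuples n m"
    using set_sum_code_subset[OF assms] by (auto simp: tuples_def)
  then show "sum_code m s ` tuples n m = tuples n m"
    using inj by (intro endo_inj_surj finite_tuples)
qed

text \<open>Both codes start with the same entry \<open>c\<close>, so the accumulators become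
  \<open>s + c\<close> and \<open>t + c\<close>, and adding \<open>c\<close> to both sides preserves
  the congruence. It serves for the constant tails of the endpoints of an edge.\<close>

lemma sum_code_replicate_cong:
  assumes "(s + a) mod m = (t + b) mod m"
  shows "sum_code m s (replicate k a) = sum_code m t (replicate k b)"
  using assms
proof (induction k arbitrary: s t)
  case (Suc k)
  define c where "c = (t + b) mod m"
  have "(s + c + a) mod m = (t + c + b) mod m"
    using mod_add_cong[OF Suc.prems refl[of "c mod m"]] by (simp add: ac_simps)
  then show ?case
    using Suc by (simp add: c_def Let_def)
qed simp

text \<open>Turns the indexed description of an edge into a list shape along which the recursion of
  \<open>sum_code\<close> can be followed; \<open>length w\<close> is the position
  \<open>h\<close>.\<close>

lemma sierpinski_arcE:
  assumes "(u, v) \<in> parcs (sierpinski_graph n m)"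
  obtains w a b k where "u = w @ a # replicate k b" "v = w @ b # replicate k a"
    "a \<noteq> b" "a < m" "b < m" "n = length w + Suc k"
proof -
  obtain h where uv: "length u = n" "length v = n" "set u \<subseteq> {0..<m}" "set v \<subseteq> {0..<m}"
    and h: "h < n" "\<forall>i<h. u ! i = v ! i" "u ! h \<noteq> v ! h"
      "\<forall>j. h < j \<and> j < n \<longrightarrow> u ! j = v ! h \<and> v ! j = u ! h"
    using assms unfolding parcs_sierpinski_graph_iff tuples_def by blast
  have "drop (Suc h) u = replicate (n - Suc h) (v ! h)"
    "drop (Suc h) v = replicate (n - Suc h) (u ! h)"
    using uv h by (auto intro!: nth_equalityI)
  moreover have "take h u = take h v"
    using uv h by (auto intro!: nth_equalityI)
  ultimately have "u = take h u @ u ! h # replicate (n - Suc h) (v ! h)"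
    "v = take h u @ v ! h # replicate (n - Suc h) (u ! h)"
    using uv h(1) by (metis id_take_nth_drop)+
  moreover have "u ! h < m" "v ! h < m"
    using uv(1,2) h(1) subsetD[OF uv(3) nth_mem, of h] subsetD[OF uv(4) nth_mem, of h] by simp_all
  ultimately show thesis
    using that h(1,3) uv(1) by simp
qed

lemma sum_code_arc_ex1:
  assumes "(u, v) \<in> parcs (sierpinski_graph n m)"
  shows "\<exists>!i. i < n \<and> sum_code m s u ! i \<noteq> sum_code m s v ! i"
proof -
  obtain w a b k where u: "u = w @ a # replicate k b" and v: "v = w @ b # replicate k a"
    and ab: "a \<noteq> b" "a < m" "b < m" and n: "n = length w + Suc k"
    using assms by (rule sierpinski_arcE)
  define p where "p = sum_code m s w"
  define t where "t = s + sum_list p"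
  define c where "c = (t + a) mod m"
  define d where "d = (t + b) mod m"
  \<comment> \<open>Both sides are congruent to \<open>2 * t + a + b\<close>. The swap of
    \<open>a\<close> and \<open>b\<close> in the tails thus makes up for the different accumulators
    \<open>t + c\<close> and \<open>t + d\<close>.\<close>
  have "(t + b + c) mod m = (t + a + d) mod m"
    unfolding c_def d_def mod_add_right_eq by (simp only: add.commute)
  then have "(t + c + b) mod m = (t + d + a) mod m"
    by (simp only: ac_simps)
  then have "sum_code m (t + c) (replicate k b) = sum_code m (t + d) (replicate k a)"
    by (rule sum_code_replicate_cong)
  then obtain q where "sum_code m s u = p @ c # q" "sum_code m s v = p @ d # q"
    by (simp add: u v sum_code_append p_def t_def c_def d_def Let_def)
  moreover have "c \<noteq> d"
    using ab mod_add_left_cancel_less unfolding c_def d_def by blast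
  moreover have "length p = length w"
    by (simp add: p_def)
  ultimately show ?thesis
    by (intro ex1I[of _ "length w"])
      (auto simp: n nth_append nth_Cons split: if_splits nat.splits)
qed

text \<open>Arcs are pairs of vertices, so injectivity of \<open>f\<close> on vertices passes to
  \<open>map_prod f f\<close> on arcs.\<close>

lemma digraph_iso_image:
  assumes "pair_wf_digraph G" "inj_on f (pverts G)"
  shows "digraph_iso (with_proj G)
    (with_proj \<lparr>pverts = f ` pverts G, parcs = map_prod f f ` parcs G\<rparr>)"
proof -
  interpret pair_wf_digraph G by fact
  let ?hom = "\<lparr>iso_verts = f, iso_arcs = map_prod f f, iso_head = snd, iso_tail = fst\<rparr>"
  have "parcs G \<subseteq> pverts G \<times> pverts G"
    by (auto dest: wellformed')
  then have "inj_on (map_prod f f) (parcs G)"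
    by (rule inj_on_subset[OF map_prod_inj_on[OF assms(2,2)]])
  then have "digraph_isomorphism ?hom"
    using assms(2) wf_digraph_axioms unfolding digraph_isomorphism_def by simp
  then show ?thesis
    unfolding digraph_iso_def by (intro exI[of _ ?hom]) (simp add: app_iso_def with_proj_def)
qed

theorem theorem2:
  fixes n m :: nat
  assumes "n \<ge> 1" and "m \<ge> 2"
  shows "(\<exists>H :: nat list pair_pre_digraph. pair_graph H \<and>
            subgraph (with_proj H) (with_proj (hamming_graph n m)) \<and>
            digraph_iso (with_proj H) (with_proj (sierpinski_graph n m))) \<and>
         (\<exists>\<phi> :: nat list \<Rightarrow> nat list. bij_betw \<phi> (tuples n m) (tuples n m) \<and>
            (\<forall>u v. (u, v) \<in> parcs (sierpinski_graph n m) \<longrightarrow>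
              (\<exists>!i. i < n \<and> \<phi> u ! i \<noteq> \<phi> v ! i)))"
proof
  let ?S = "sierpinski_graph n m" and ?K = "hamming_graph n m"
  define \<phi> where "\<phi> = sum_code m 0"
  have bij: "bij_betw \<phi> (tuples n m) (tuples n m)"
    using assms(2) unfolding \<phi>_def by (intro bij_betw_sum_code) simp
  have edge: "\<exists>!i. i < n \<and> \<phi> u ! i \<noteq> \<phi> v ! i" if "(u, v) \<in> parcs ?S" for u v
    using that unfolding \<phi>_def by (rule sum_code_arc_ex1)
  show "\<exists>\<phi> :: nat list \<Rightarrow> nat list. bij_betw \<phi> (tuples n m) (tuples n m) \<and>
      (\<forall>u v. (u, v) \<in> parcs ?S \<longrightarrow> (\<exists>!i. i < n \<and> \<phi> u ! i \<noteq> \<phi> v ! i))"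
    using bij edge by blast
  interpret S: pair_graph ?S
    by (rule pair_graph_sierpinski_graph)
  interpret K: pair_graph ?K
    by (rule pair_graph_hamming_graph)
  \<comment> \<open>Taking the image of the Sierpinski graph makes the isomorphism automatic; what
    remains is that its arcs lie in the Hamming graph, which is the edge property of
    \<open>\<phi>\<close>.\<close>
  define H where "H = \<lparr>pverts = \<phi> ` pverts ?S, parcs = map_prod \<phi> \<phi> ` parcs ?S\<rparr>"
  have verts: "pverts H = tuples n m"
    using bij by (simp add: H_def bij_betw_def)
  have arcs: "parcs H \<subseteq> parcs ?K"
  proof
    fix e assume "e \<in> parcs H"
    then obtain u v where "e = (\<phi> u, \<phi> v)" and uv: "(u, v) \<in> parcs ?S"
      by (auto simp: H_def)
    moreover have "\<phi> u \<in> tuples n m" "\<phi> v \<in> tuples n m"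
      using S.wellformed'[OF uv] bij by (auto simp: bij_betw_def)
    ultimately show "e \<in> parcs ?K"
      using edge[OF uv] by (simp only: parcs_hamming_graph_iff simp_thms)
  qed
  have "(y, x) \<in> parcs H" if "(x, y) \<in> parcs H" for x y
    using that S.arcs_symmetric by (force simp: H_def)
  \<comment> \<open>Symmetry comes from the Sierpinski graph, absence of loops from the Hamming
    graph.\<close>
  then interpret H: pair_graph H
    using arcs K.wellformed' K.pair_no_loops by (intro pair_graphI_tuples[OF verts]) fastforce
  have "subgraph (with_proj H) (with_proj ?K)"
    by (rule subgraphI)
      (use verts arcs H.wf_digraph_axioms K.wf_digraph_axioms in \<open>simp_all add: compatible_def\<close>)
  moreover have "digraph_iso (with_proj ?S) (with_proj H)"
    unfolding H_def using bij S.pair_wf_digraph_axioms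
    by (intro digraph_iso_image) (simp_all add: bij_betw_def)
  then have "digraph_iso (with_proj H) (with_proj ?S)"
    by (rule digraph_iso_swap[OF S.wf_digraph_axioms])
  ultimately show "\<exists>H :: nat list pair_pre_digraph. pair_graph H \<and>
      subgraph (with_proj H) (with_proj ?K) \<and> digraph_iso (with_proj H) (with_proj ?S)"
    using H.pair_graph_axioms by blast
qed

end
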